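(* Let $k$ be an odd positive integer, $n=4k$, and $d=\frac{(3^{2k}+1)^2}{20}$ (an integer). Let $\alpha$ be a primitive element of $\mathrm{GF}(3^n)$ and let $\{s_t\}$ be the ternary $m$-sequence $s_t=\mathrm{Tr}_1^n(\alpha^t)$ of period $3^n-1$. Then for every shift $\tau$ with $0\le \tau\le 3^n-2$, the cross-correlation $$C_d(\tau)=\sum_{t=0}^{3^n-2}\omega^{s_{t+\tau}-s_{dt}}$$ between $\{s_t\}$ and its decimation $\{s_{dt}\}$ satisfies $$|C_d(\tau)|\le 5\cdot 3^{n/2}+1 = 5\sqrt{3^n}+1.$$
   Context: $\omega=e^{2\pi\sqrt{-1}/3}$ is a primitive complex cube root of unity. For $m\mid n$, $\mathrm{Tr}_m^n:\mathrm{GF}(3^n)\to\mathrm{GF}(3^m)$ denotes the trace map $\mathrm{Tr}_m^n(x)=x+x^{3^m}+x^{3^{2m}}+\cdots+x^{3^{(n/m-1)m}}$. Exponents $s_{t+\tau}-s_{dt}$ are elements of $\mathrm{GF}(3)=\mathbb{Z}/3\mathbb{Z}$, so $\omega^{s}$ is well defined. *)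

theory Defs
  imports Complex_Main
begin

definition omega :: complex where
  "omega = cis (2 * pi / 3)"

definition trace3 :: "nat \<Rightarrow> 'a::field \<Rightarrow> 'a" where
  "trace3 n x = (\<Sum>i<n. x ^ (3 ^ i))"

definition primitive_element :: "'a::field \<Rightarrow> bool" where
  "primitive_element a \<longleftrightarrow> a \<noteq> 0 \<and> (\<forall>x. x \<noteq> 0 \<longrightarrow> (\<exists>i::nat. x = a ^ i))"

text \<open>Identification of the prime field GF(3) inside the field with Z/3Z:
  the representative j in {0,1,2} with of_nat j = x.\<close>
definition gf3_val :: "'a::field \<Rightarrow> nat" where
  "gf3_val x = (THE j. j < 3 \<and> of_nat j = x)"

definition omega_pow_diff :: "'a::field \<Rightarrow> 'a \<Rightarrow> complex" where
  "omega_pow_diff a b = omega ^ gf3_val a * inverse (omega ^ gf3_val b)"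

definition mseq :: "nat \<Rightarrow> 'a::field \<Rightarrow> nat \<Rightarrow> 'a" where
  "mseq n \<alpha> t = trace3 n (\<alpha> ^ t)"

definition crosscorr :: "nat \<Rightarrow> 'a::field \<Rightarrow> nat \<Rightarrow> nat \<Rightarrow> complex" where
  "crosscorr n \<alpha> d \<tau> =
     (\<Sum>t\<in>{0..3^n - 2}. omega_pow_diff (mseq n \<alpha> (t + \<tau>)) (mseq n \<alpha> (d * t)))"

end

theory Submission
  imports Defs "HOL-Library.Cardinality" "HOL-Computational_Algebra.Polynomial"
begin

text \<open>
  Write \<open>Q = 3\<^bsup>2k\<^esup>\<close> and \<open>N = Q\<^sup>2 - 1\<close>, and let \<open>\<psi>\<close> be the canonical additive character. The
  nonzero squares are covered twice by \<open>v \<mapsto> v\<^bsup>Q+9\<^esup>\<close>, since \<open>(Q+9)/2\<close> is coprime to \<open>N\<close>, and the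
  nonsquares twice by \<open>v \<mapsto> \<alpha>v\<^sup>2\<close>. For \<open>x = v\<^bsup>Q+9\<^esup>\<close> one has \<open>x\<^sup>d = v\<^bsup>Q+1\<^esup>\<close>, whereas for a nonsquare \<open>x\<close>
  the relation \<open>x\<^bsup>dQ\<^esup> = -x\<^sup>d\<close> forces \<open>x\<^sup>d\<close> to have trace zero. Hence twice the
  correlation is, up to the two terms \<open>v = 0\<close>, a sum of two exponential sums of quadratic forms,
  with arguments \<open>a\<alpha>v\<^sup>2\<close> and \<open>av\<^bsup>Q+9\<^esup> - v\<^bsup>Q+1\<^esup>\<close>, where \<open>a = \<alpha>\<^sup>\<tau>\<close>. The radical of
  the first form is trivial and that of the second is the zero set of a polynomial of degree 81,
  so these sums are at most \<open>Q\<close> and \<open>9Q\<close> in absolute value.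
\<close>

section \<open>Power maps, reindexing of sums and root counting\<close>

lemma pow_card_minus_one:
  fixes x :: "'a::{field,finite}"
  assumes "x \<noteq> 0"
  shows "x ^ (CARD('a) - 1) = 1"
proof -
  \<comment> \<open>Multiplication by \<open>x\<close> permutes the nonzero elements; their product
    is nonzero and cancels.\<close>
  have "(\<Prod>y\<in>UNIV - {0}. y) = (\<Prod>y\<in>UNIV - {0}. x * y)"
    using assms
    by (intro prod.reindex_bij_witness[of _ "\<lambda>y. x * y" "\<lambda>y. y / x"]) auto
  also have "\<dots> = x ^ (CARD('a) - 1) * (\<Prod>y\<in>UNIV - {0}. y)"
    by (simp add: prod.distrib card_Diff_singleton)
  finally show ?thesis
    by simp
qed

text \<open>A Bezout inverse \<open>u\<close> of \<open>e\<close> modulo \<open>N\<close> recovers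
  \<open>x\<close> as \<open>(x ^ e) ^ u\<close>. If \<open>e = 0\<close>, coprimality forces
  \<open>N = 1\<close>, so 1 is the only nonzero element.\<close>

lemma inj_on_power_coprime:
  fixes e N :: nat
  assumes "coprime e N" and N: "\<And>x::'a::field. x \<noteq> 0 \<Longrightarrow> x ^ N = 1"
  shows "inj_on (\<lambda>x::'a. x ^ e) (UNIV - {0})"
proof (rule inj_onI)
  fix x y :: 'a
  assume *: "x \<in> UNIV - {0}" "y \<in> UNIV - {0}" "x ^ e = y ^ e"
  show "x = y"
  proof (cases "e = 0")
    case True
    then have "N = 1" using assms(1) by simp
    then show ?thesis using * N[of x] N[of y] by simp
  next
    case False
    obtain u v where uv: "e * u = N * v + 1"
      using bezout_nat[OF False, of N] assms(1) by auto
    have "z ^ (e * u) = z" if "z \<noteq> 0" for z :: 'a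
      unfolding uv using N[OF that] by (simp add: power_add power_mult)
    then have "(x ^ e) ^ u = x" "(y ^ e) ^ u = y"
      using *(1,2) by (simp_all add: power_mult)
    then show ?thesis using *(3) by metis
  qed
qed

lemma sum_lessThan_double:
  fixes f :: "nat \<Rightarrow> 'b::comm_monoid_add"
  shows "(\<Sum>t<2 * N. f t) = (\<Sum>s<N. f (2 * s)) + (\<Sum>s<N. f (2 * s + 1))"
  by (induction N) (auto simp: algebra_simps)

lemma sum_lessThan_add:
  fixes f :: "nat \<Rightarrow> 'b::comm_monoid_add"
  shows "(\<Sum>t<M + N. f t) = (\<Sum>t<M. f t) + (\<Sum>t<N. f (M + t))"
  by (induction N) (auto simp: algebra_simps)

text \<open>The equation is the one defining the radical of the form with exponents
  \<open>Q + 9\<close> and \<open>Q + 1\<close>.\<close>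

lemma radical_card:
  fixes b c :: "'a::idom"
  assumes "b \<noteq> 0"
  shows "card {z. b * z ^ 81 + z ^ 9 + c * z = 0} \<le> 81"
proof -
  define p where "p = monom b 81 + monom 1 9 + monom c 1"
  have "coeff p 81 = b" by (simp add: p_def)
  then have "p \<noteq> 0" using assms by auto
  moreover have "degree p \<le> 81"
    unfolding p_def by (intro degree_add_le order.trans[OF degree_monom_le]) auto
  ultimately have "card {z. poly p z = 0} \<le> 81"
    using card_poly_roots_bound[of p] by simp
  then show ?thesis by (simp add: p_def poly_monom)
qed

lemma omega_cube: "omega ^ 3 = 1"
  by (simp add: omega_def DeMoivre)

lemma omega_neq: "omega \<noteq> 1" "omega ^ 2 \<noteq> 1"
proof -
  have "Im omega = sqrt 3 / 2" by (simp add: omega_def sin_120)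
  then show "omega \<noteq> 1" by auto
  then show "omega ^ 2 \<noteq> 1" using omega_cube by (auto simp: power3_eq_cube power2_eq_square)
qed

section \<open>Characteristic 3, Frobenius and trace\<close>

locale finite_field_3n =
  fixes n :: nat and ty :: "'a::{field,finite} itself"
  assumes card_field: "CARD('a) = 3 ^ n"
begin

lemma n_pos: "n > 0"
proof (rule ccontr)
  assume "\<not> n > 0"
  then have "card (UNIV :: 'a set) = 1" using card_field by simp
  then obtain c where "(UNIV :: 'a set) = {c}" by (rule card_1_singletonE)
  then have "(0::'a) = c" "(1::'a) = c" by blast+
  then show False by simp
qed

text \<open>Translation by 1 permutes the field, so the sum of all elements absorbs
  \<open>3 ^ n\<close>; hence \<open>3 ^ n = 0\<close>, and a field has no nilpotents.\<close>

lemma char_3: "(3::'a) = 0"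
proof -
  have "(\<Sum>x\<in>UNIV. x::'a) = (\<Sum>x\<in>UNIV. x + 1)"
    by (rule sum.reindex_bij_witness[of _ "\<lambda>x. x + 1" "\<lambda>x. x - 1"]) auto
  also have "\<dots> = (\<Sum>x\<in>UNIV. x) + of_nat (CARD('a))"
    by (simp add: sum.distrib)
  finally have "of_nat (CARD('a)) = (0::'a)" by simp
  then have "(3::'a) ^ n = 0" by (simp add: card_field)
  then show ?thesis by simp
qed

lemma two_neq_0: "(2::'a) \<noteq> 0"
proof
  assume "(2::'a) = 0"
  moreover have "(3::'a) = 2 + 1" by simp
  ultimately show False using char_3 by simp
qed

lemma double_eq_uminus: "2 * x = - (x::'a)"
proof -
  have "2 * x + x = 3 * x" by (simp add: algebra_simps)
  then show ?thesis using char_3 by (simp add: eq_neg_iff_add_eq_0)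
qed

lemma cube_add: "((x::'a) + y) ^ 3 = x ^ 3 + y ^ 3"
proof -
  have "(x + y) ^ 3 = x ^ 3 + y ^ 3 + 3 * (x\<^sup>2 * y + x * y\<^sup>2)"
    by (simp add: power3_eq_cube power2_eq_square algebra_simps)
  then show ?thesis using char_3 by simp
qed

lemma frob_add: "((x::'a) + y) ^ (3 ^ i) = x ^ (3 ^ i) + y ^ (3 ^ i)"
proof (induction i)
  case (Suc i)
  then show ?case by (simp add: mult.commute[of 3] power_mult cube_add)
qed simp

lemma frob_uminus: "(- (x::'a)) ^ (3 ^ i) = - (x ^ (3 ^ i))"
  by (simp add: power_minus_odd)

lemma frob_diff: "((x::'a) - y) ^ (3 ^ i) = x ^ (3 ^ i) - y ^ (3 ^ i)"
  using frob_add[of x "- y" i] by (simp add: frob_uminus)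

lemma inj_frob: "inj (\<lambda>x::'a. x ^ (3 ^ i))"
proof (rule injI)
  fix x y :: 'a
  assume "x ^ 3 ^ i = y ^ 3 ^ i"
  then have "(x - y) ^ 3 ^ i = 0" by (simp add: frob_diff)
  then show "x = y" by simp
qed

lemma bij_frob: "bij (\<lambda>x::'a. x ^ (3 ^ i))"
  using inj_frob[of i] finite_UNIV_inj_surj[OF finite inj_frob[of i]] by (simp add: bij_def)

lemma pow_order: "(x::'a) \<noteq> 0 \<Longrightarrow> x ^ (3 ^ n - 1) = 1"
  using pow_card_minus_one[of x] card_field by simp

lemma frob_n: "(x::'a) ^ (3 ^ n) = x"
proof (cases "x = 0")
  case False
  have "x ^ (3 ^ n) = x ^ (3 ^ n - 1) * x"
    by (metis power_minus_mult zero_less_numeral zero_less_power)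
  then show ?thesis using pow_order[OF False] by simp
qed simp

lemma trace_add: "trace3 n ((x::'a) + y) = trace3 n x + trace3 n y"
  by (simp add: trace3_def frob_add sum.distrib)

lemma trace_uminus: "trace3 n (- (x::'a)) = - trace3 n x"
  by (simp add: trace3_def frob_uminus sum_negf)

text \<open>Cubing shifts the conjugates cyclically: the last one, \<open>x ^ 3 ^ n\<close>, is
  \<open>x\<close> again.\<close>

lemma trace_cube: "trace3 n ((x::'a) ^ 3) = trace3 n x"
proof -
  have "trace3 n (x ^ 3) + x = (\<Sum>i<Suc n. x ^ 3 ^ i)"
    by (subst sum.lessThan_Suc_shift) (simp add: trace3_def power_mult add.commute)
  also have "\<dots> = trace3 n x + x"
    by (simp add: trace3_def frob_n)
  finally show ?thesis by simp
qed

lemma trace_pow3: "trace3 n (x ^ 3) = (trace3 n (x::'a)) ^ 3"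
proof -
  have "(\<Sum>i<m. x ^ 3 ^ i) ^ 3 = (\<Sum>i<m. (x ^ 3) ^ 3 ^ i)" for m
    by (induction m) (simp_all add: cube_add mult.commute flip: power_mult)
  then show ?thesis by (simp add: trace3_def)
qed

lemma trace_frob: "trace3 n ((x::'a) ^ 3 ^ i) = trace3 n x"
  by (induction i) (simp_all add: mult.commute[of 3] power_mult trace_cube)

text \<open>The trace is fixed by cubing, and modulo 3 the polynomial \<open>t ^ 3 - t\<close>
  splits as \<open>t * (t - 1) * (t - 2)\<close>.\<close>

lemma trace_range: "trace3 n (x::'a) \<in> {0, 1, 2}"
proof -
  define t where "t = trace3 n x"
  have "t ^ 3 = t" using trace_cube[of x] trace_pow3[of x] by (simp add: t_def)
  moreover have "t * (t - 1) * (t - 2) = t ^ 3 - t + 3 * (t - t\<^sup>2)"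
    by (simp add: power3_eq_cube power2_eq_square algebra_simps)
  ultimately have "t * (t - 1) * (t - 2) = 0" using char_3 by simp
  then show ?thesis by (auto simp: t_def)
qed

lemma gf3_val_simps: "gf3_val (0::'a) = 0" "gf3_val (1::'a) = 1" "gf3_val (2::'a) = 2"
proof -
  have less_3: "j < 3 \<longleftrightarrow> j = 0 \<or> j = 1 \<or> j = 2" for j :: nat by auto
  have "(2::'a) \<noteq> 1" using double_eq_uminus[of 1] two_neq_0
    by (metis add_left_cancel mult.right_neutral one_add_one one_neq_zero add_0_right)
  then show "gf3_val (0::'a) = 0" "gf3_val (1::'a) = 1" "gf3_val (2::'a) = 2"
    unfolding gf3_val_def less_3 using two_neq_0 by (auto intro!: the_equality)
qed

section \<open>The canonical additive character\<close>

definition psi :: "'a \<Rightarrow> complex" where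
  "psi x = omega ^ gf3_val (trace3 n x)"

lemma norm_psi [simp]: "norm (psi x) = 1"
  by (simp add: psi_def omega_def norm_power)

lemma psi_add: "psi (x + y) = psi x * psi y"
proof -
  \<comment> \<open>Nine cases of trace values remain; 4 arises as 2 + 2, and
    \<open>omega_cube\<close> absorbs the carries.\<close>
  have four: "(4::'a) = 1"
  proof -
    have "(4::'a) = 3 + 1" by simp
    then show ?thesis using char_3 by simp
  qed
  have o: "omega * (omega * omega) = 1" "omega * (omega * (omega * omega)) = omega"
    using omega_cube by (simp_all add: power3_eq_cube mult.assoc)
  show ?thesis
    using trace_range[of x] trace_range[of y]
    by (auto simp: psi_def trace_add gf3_val_simps four char_3 power2_eq_square o mult.assoc)
qed

lemma psi_0 [simp]: "psi 0 = 1"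
  by (simp add: psi_def trace3_def gf3_val_simps power_0_left)

lemma psi_uminus: "psi (- x) = inverse (psi x)"
  using psi_add[of x "- x"] by (simp add: inverse_unique)

lemma cnj_psi: "cnj (psi x) = psi (- x)"
  using complex_norm_square[of "psi x"] by (simp add: psi_uminus inverse_unique)

lemma psi_frob: "psi (x ^ 3 ^ i) = psi x"
  by (simp add: psi_def trace_frob)

lemma psi_eq_1: "trace3 n x = 0 \<Longrightarrow> psi x = 1"
  by (simp add: psi_def gf3_val_simps)

text \<open>The trace is a nonzero polynomial of degree at most \<open>3 ^ (n - 1)\<close>, too
  small to vanish on the whole field.\<close>

lemma ex_psi_neq_1: "\<exists>x. psi x \<noteq> 1"
proof -
  define p :: "'a poly" where "p = (\<Sum>i<n. monom 1 (3 ^ i))"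
  have poly_p: "poly p x = trace3 n x" for x
    by (simp add: p_def trace3_def poly_sum poly_monom)
  have "coeff p (3 ^ (n - 1)) = (\<Sum>i<n. if i = n - 1 then 1 else 0)"
    unfolding p_def coeff_sum by (intro sum.cong) auto
  also have "\<dots> = 1" using n_pos by simp
  finally have "p \<noteq> 0" by auto
  moreover have "degree p \<le> 3 ^ (n - 1)"
    unfolding p_def
    by (intro degree_sum_le) (auto intro!: order.trans[OF degree_monom_le] power_increasing)
  ultimately have "card {x. poly p x = 0} \<le> 3 ^ (n - 1)"
    using card_poly_roots_bound order.trans by metis
  also have "\<dots> < CARD('a)"
    using n_pos by (simp add: card_field)
  finally have "{x. poly p x = 0} \<noteq> UNIV" by (metis less_irrefl)
  then obtain x where "trace3 n x \<noteq> (0::'a)" unfolding poly_p by blast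
  then have "psi x \<noteq> 1"
    using trace_range[of x] omega_neq by (auto simp: psi_def gf3_val_simps)
  then show ?thesis ..
qed

text \<open>Translation by some \<open>c\<close> with \<open>psi c \<noteq> 1\<close> multiplies the
  sum by \<open>psi c\<close> yet leaves it unchanged.\<close>

lemma sum_psi: "(\<Sum>x\<in>UNIV. psi x) = 0"
proof -
  obtain c where c: "psi c \<noteq> 1" using ex_psi_neq_1 by blast
  have "(\<Sum>x\<in>UNIV. psi x) = (\<Sum>x\<in>UNIV. psi (c + x))"
    by (rule sum.reindex_bij_witness[of _ "\<lambda>x. c + x" "\<lambda>x. x - c"]) auto
  also have "\<dots> = psi c * (\<Sum>x\<in>UNIV. psi x)"
    by (simp add: psi_add sum_distrib_left)
  finally show ?thesis using c by auto
qed

section \<open>Exponential sums of quadratic forms\<close>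

lemma sum_psi_mult:
  fixes p :: "'a \<Rightarrow> 'a" and c :: 'a
  assumes "bij p"
  shows "(\<Sum>x\<in>UNIV. psi (p x * c)) = (if c = 0 then 3 ^ n else 0)"
proof (cases "c = 0")
  case True
  then show ?thesis by (simp add: card_field)
next
  case False
  \<comment> \<open>The bijection is substituted away; below, \<open>p\<close> is either
    \<open>id\<close> or a Frobenius power.\<close>
  have "(\<Sum>x\<in>UNIV. psi (p x * c)) = (\<Sum>x\<in>UNIV. psi (x * c))"
    by (rule sum.reindex_bij_betw[OF assms])
  also have "\<dots> = (\<Sum>x\<in>UNIV. psi x)"
    using False by (intro sum.reindex_bij_witness[of _ "\<lambda>x. x / c" "\<lambda>x. x * c"]) auto
  finally show ?thesis using False sum_psi by simp
qed

text \<open>\<open>{z. L z = 0}\<close> is the radical of the quadratic form \<open>q\<close>.\<close>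

lemma quadratic_sum_bound:
  fixes q p L :: "'a \<Rightarrow> 'a"
  assumes q: "\<And>v z. psi (q (v + z) - q v) = psi (q z) * psi (p v * L z)"
    and "bij p" and R: "card {z. L z = 0} \<le> R"
  shows "(norm (\<Sum>v\<in>UNIV. psi (q v)))\<^sup>2 \<le> 3 ^ n * real R"
proof -
  define T where "T = (\<Sum>v\<in>UNIV. psi (q v))"
  have "T * cnj T = (\<Sum>v\<in>UNIV. \<Sum>u\<in>UNIV. psi (q u) * cnj (psi (q v)))"
    unfolding T_def cnj_sum sum_product by (rule sum.swap)
  also have "\<dots> = (\<Sum>v\<in>UNIV. \<Sum>u\<in>UNIV. psi (q u - q v))"
    by (simp add: cnj_psi flip: psi_add)
  also have "\<dots> = (\<Sum>v\<in>UNIV. \<Sum>z\<in>UNIV. psi (q (v + z) - q v))"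
  proof (rule sum.cong[OF refl])
    fix v
    show "(\<Sum>u\<in>UNIV. psi (q u - q v)) = (\<Sum>z\<in>UNIV. psi (q (v + z) - q v))"
      by (rule sum.reindex_bij_witness[of _ "\<lambda>z. v + z" "\<lambda>u. u - v"]) auto
  qed
  \<comment> \<open>Summing over \<open>v\<close> first, orthogonality kills every \<open>z\<close>
    outside the radical.\<close>
  also have "\<dots> = (\<Sum>z\<in>UNIV. psi (q z) * (\<Sum>v\<in>UNIV. psi (p v * L z)))"
    by (subst sum.swap) (simp add: q sum_distrib_left)
  also have "\<dots> = (\<Sum>z\<in>UNIV. if L z = 0 then psi (q z) * 3 ^ n else 0)"
    by (simp add: sum_psi_mult[OF \<open>bij p\<close>] if_distrib cong: if_cong)
  also have "\<dots> = (\<Sum>z | L z = 0. psi (q z) * 3 ^ n)"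
    by (simp add: sum.If_cases)
  finally have "norm (T * cnj T) \<le> (\<Sum>z | L z = 0. norm (psi (q z) * 3 ^ n))"
    by (simp only: norm_sum)
  then have "(norm T)\<^sup>2 \<le> real (card {z. L z = 0}) * 3 ^ n"
    by (simp add: norm_mult norm_power power2_eq_square)
  also have "\<dots> \<le> real R * 3 ^ n"
    using R by (intro mult_right_mono) auto
  finally show ?thesis by (simp add: T_def mult.commute)
qed

lemma gauss_sum_bound:
  fixes b :: 'a
  assumes "b \<noteq> 0"
  shows "(norm (\<Sum>v\<in>UNIV. psi (b * v\<^sup>2)))\<^sup>2 \<le> 3 ^ n"
proof -
  have "psi (b * (v + z)\<^sup>2 - b * v\<^sup>2) = psi (b * z\<^sup>2) * psi (id v * (2 * b * z))" for v z
    unfolding psi_add[symmetric] by (simp add: power2_eq_square algebra_simps)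
  moreover have "card {z::'a. 2 * b * z = 0} \<le> 1"
    using assms two_neq_0 by simp
  ultimately show ?thesis
    using quadratic_sum_bound[of "\<lambda>v. b * v\<^sup>2" id "\<lambda>z. 2 * b * z" 1] by simp
qed

text \<open>The polarisation mixes \<open>v\<close>, \<open>v ^ 9\<close> and \<open>v ^ Q\<close>.
  Since \<open>psi\<close> is invariant under Frobenius, each term can be raised to a power so that
  \<open>v\<close> occurs only as \<open>v ^ (9 * Q)\<close>; what multiplies it is
  \<open>L z\<close>.\<close>

lemma quadratic_sum_bound_Q:
  fixes a :: 'a and m :: nat
  assumes "n = 2 * m" "a \<noteq> 0"
  defines "Q \<equiv> 3 ^ m"
  shows "(norm (\<Sum>v\<in>UNIV. psi (a * v ^ (Q + 9) - v ^ (Q + 1))))\<^sup>2 \<le> 3 ^ n * 81"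
proof -
  define L where "L z = a ^ 9 * z ^ 81 + z ^ 9 + a ^ Q * z" for z :: 'a
  have QQ: "x ^ (Q * Q) = x" for x :: 'a
    using frob_n[of x] by (simp add: Q_def assms(1) mult_2 power_add)
  have add9: "(x + y) ^ 9 = x ^ 9 + y ^ 9" for x y :: 'a
    using frob_add[of x y 2] by simp
  have addQ: "(x + y) ^ Q = x ^ Q + y ^ Q" for x y :: 'a
    by (simp add: Q_def frob_add)
  have psi9: "psi (x ^ 9) = psi x" for x using psi_frob[of x 2] by simp
  have psiQ: "psi (x ^ Q) = psi x" for x by (simp add: Q_def psi_frob)
  have swap: "(x ^ 9) ^ Q = (x ^ Q) ^ 9" for x :: 'a
    by (simp add: mult.commute flip: power_mult)
  have QQ': "(x ^ Q) ^ Q = x" for x :: 'a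
    using QQ by (simp flip: power_mult)
  have B: "psi (a * (v ^ Q * z ^ 9 + v ^ 9 * z ^ Q) - v ^ Q * z - v * z ^ Q) = psi (v ^ (3 ^ (m + 2)) * L z)"
    (is "?l = ?r") for v z
  proof -
    have v: "v ^ (3 ^ (m + 2)) = (v ^ Q) ^ 9"
      by (simp add: Q_def power_add mult.commute flip: power_mult)
    have e1: "psi (a * (v ^ Q * z ^ 9)) = psi ((v ^ Q) ^ 9 * (a ^ 9 * z ^ 81))"
      by (subst psi9[symmetric]) (simp add: power_mult_distrib mult_ac flip: power_mult)
    have e2: "psi (a * (v ^ 9 * z ^ Q)) = psi ((v ^ Q) ^ 9 * (a ^ Q * z))"
      \<comment> \<open>Raising to the power \<open>Q\<close> turns \<open>z ^ Q\<close> back into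
        \<open>z\<close>, as \<open>Q * Q = 3 ^ n\<close>.\<close>
      using psiQ[of "a * (v ^ 9 * z ^ Q)", symmetric]
      by (simp only: power_mult_distrib QQ' swap mult_ac)
    have e3: "psi (v ^ Q * z) = psi ((v ^ Q) ^ 9 * z ^ 9)"
      using psi9[of "v ^ Q * z", symmetric] by (simp only: power_mult_distrib)
    have "psi (v * z ^ Q) = psi (v ^ Q * z)"
      using psiQ[of "v * z ^ Q", symmetric] by (simp only: power_mult_distrib QQ')
    then have e4: "psi (v * z ^ Q) = psi ((v ^ Q) ^ 9 * z ^ 9)"
      using e3 by simp
    define w where "w = (v ^ Q) ^ 9"
    have "?l = psi (a * (v ^ Q * z ^ 9) + a * (v ^ 9 * z ^ Q) + (- (v ^ Q * z)) + (- (v * z ^ Q)))"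
      by (simp add: algebra_simps)
    also have "\<dots> = psi (w * (a ^ 9 * z ^ 81)) * psi (w * (a ^ Q * z)) * psi (- (w * z ^ 9)) * psi (- (w * z ^ 9))"
      by (simp only: psi_add psi_uminus e1 e2 e3 e4 w_def)
    also have "\<dots> = psi (w * (a ^ 9 * z ^ 81) + w * (a ^ Q * z) + - (2 * (w * z ^ 9)))"
      unfolding psi_add[symmetric] by (simp add: algebra_simps)
    \<comment> \<open>In characteristic 3 the coefficient -2 is 1, whence the plain
      \<open>z ^ 9\<close> in \<open>L\<close>.\<close>
    also have "\<dots> = psi (w * L z)"
      by (simp only: double_eq_uminus) (simp add: L_def algebra_simps)
    finally show ?thesis by (simp only: v w_def)
  qed
  have "psi ((a * (v + z) ^ (Q + 9) - (v + z) ^ (Q + 1)) - (a * v ^ (Q + 9) - v ^ (Q + 1)))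
      = psi (a * z ^ (Q + 9) - z ^ (Q + 1)) * psi (v ^ (3 ^ (m + 2)) * L z)" for v z
    unfolding B[symmetric]
    unfolding psi_add[symmetric] power_add power_one_right addQ add9
    by (rule arg_cong[of _ _ psi]) (simp add: algebra_simps)
  moreover have "card {z. L z = 0} \<le> 81"
    unfolding L_def using assms(2) by (intro radical_card) simp
  ultimately show ?thesis
    using quadratic_sum_bound[of "\<lambda>v. a * v ^ (Q + 9) - v ^ (Q + 1)"
        "\<lambda>v. v ^ (3 ^ (m + 2))" L 81, OF _ bij_frob] by simp
qed

section \<open>Sums over the powers of a primitive element\<close>

context
  fixes \<alpha> :: 'a
  assumes prim: "primitive_element \<alpha>"
begin

lemma primitive_neq_0: "\<alpha> \<noteq> 0"
  using prim by (simp add: primitive_element_def)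

lemma primitive_power_period: "\<alpha> ^ (3 ^ n - 1 + t) = \<alpha> ^ t"
  using pow_order[OF primitive_neq_0] by (simp only: power_add mult_1)

lemma bij_primitive_power: "bij_betw (\<lambda>t. \<alpha> ^ t) {..<3 ^ n - 1} (UNIV - {0})"
proof -
  have N: "(3::nat) ^ n - 1 > 0" using n_pos one_less_power[of "3::nat" n] by simp
  have img: "(\<lambda>t. \<alpha> ^ t) ` {..<3 ^ n - 1} = UNIV - {0}"
  proof (intro equalityI subsetI)
    fix x :: 'a assume "x \<in> UNIV - {0}"
    then obtain i where i: "x = \<alpha> ^ i" using prim by (auto simp: primitive_element_def)
    have "i = (3 ^ n - 1) * (i div (3 ^ n - 1)) + i mod (3 ^ n - 1)" by simp
    then have "x = (\<alpha> ^ (3 ^ n - 1)) ^ (i div (3 ^ n - 1)) * \<alpha> ^ (i mod (3 ^ n - 1))"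
      unfolding i by (metis power_add power_mult)
    then have "x = \<alpha> ^ (i mod (3 ^ n - 1))"
      using pow_order[OF primitive_neq_0] by simp
    then show "x \<in> (\<lambda>t. \<alpha> ^ t) ` {..<3 ^ n - 1}" using N by auto
  qed (use primitive_neq_0 in auto)
  \<comment> \<open>Injectivity by counting: domain and image both have \<open>3 ^ n - 1\<close>
    elements.\<close>
  moreover have "inj_on (\<lambda>t. \<alpha> ^ t) {..<3 ^ n - 1}"
    by (rule eq_card_imp_inj_on, simp, unfold img) (simp add: card_Diff_singleton card_field)
  ultimately show ?thesis by (simp add: bij_betw_def)
qed

lemma primitive_power_half:
  assumes "2 * h = 3 ^ n - 1"
  shows "\<alpha> ^ h = - 1"
proof -
  have N: "(3::nat) ^ n - 1 > 0" using n_pos one_less_power[of "3::nat" n] by simp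
  have h: "h > 0" "h < 3 ^ n - 1" using assms N by auto
  have "(\<alpha> ^ h)\<^sup>2 = 1"
    using pow_order[OF primitive_neq_0] assms by (simp add: mult.commute flip: power_mult)
  moreover have "\<alpha> ^ h \<noteq> 1"
    using inj_onD[OF bij_betw_imp_inj_on[OF bij_primitive_power], of h 0] h N
    by auto
  ultimately show ?thesis by (simp add: power2_eq_1_iff)
qed

text \<open>Two periods of \<open>t\<close> are split by parity. Even exponents give the squares,
  where \<open>v \<mapsto> v ^ e\<close> may be applied first as it permutes the nonzero elements;
  odd ones give \<open>\<alpha>\<close> times a square.\<close>

lemma double_sum_nonzero:
  fixes F :: "'a \<Rightarrow> complex"
  assumes "coprime e (3 ^ n - 1)"
  shows "2 * (\<Sum>t<3 ^ n - 1. F (\<alpha> ^ t))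
    = (\<Sum>v\<in>UNIV - {0}. F (v ^ (2 * e))) + (\<Sum>v\<in>UNIV - {0}. F (\<alpha> * v\<^sup>2))"
proof -
  define N :: nat where "N = 3 ^ n - 1"
  have "inj_on (\<lambda>v::'a. v ^ e) (UNIV - {0})"
    using assms pow_order by (rule inj_on_power_coprime)
  moreover from this have "(\<lambda>v::'a. v ^ e) ` (UNIV - {0}) = UNIV - {0}"
    by (intro endo_inj_surj) auto
  ultimately have "bij_betw (\<lambda>v::'a. v ^ e) (UNIV - {0}) (UNIV - {0})"
    by (simp add: bij_betw_def)
  from sum.reindex_bij_betw[OF this, of "\<lambda>v. F (v\<^sup>2)"]
  have "(\<Sum>v\<in>UNIV - {0}. F (v ^ (2 * e))) = (\<Sum>v\<in>UNIV - {0}. F (v\<^sup>2))"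
    by (simp add: mult.commute flip: power_mult)
  also have "\<dots> = (\<Sum>s<N. F (\<alpha> ^ (2 * s)))"
    using sum.reindex_bij_betw[OF bij_primitive_power, of "\<lambda>v. F (v\<^sup>2)"]
    by (simp add: N_def mult.commute flip: power_mult)
  finally have even: "(\<Sum>v\<in>UNIV - {0}. F (v ^ (2 * e))) = (\<Sum>s<N. F (\<alpha> ^ (2 * s)))" .
  have odd: "(\<Sum>v\<in>UNIV - {0}. F (\<alpha> * v\<^sup>2)) = (\<Sum>s<N. F (\<alpha> ^ (2 * s + 1)))"
    using sum.reindex_bij_betw[OF bij_primitive_power, of "\<lambda>v. F (\<alpha> * v\<^sup>2)"]
    by (simp add: N_def mult.commute flip: power_mult)
  have "2 * (\<Sum>t<N. F (\<alpha> ^ t)) = (\<Sum>t<N + N. F (\<alpha> ^ t))"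
    unfolding sum_lessThan_add by (simp only: N_def primitive_power_period mult_2)
  also have "\<dots> = (\<Sum>t<2 * N. F (\<alpha> ^ t))"
    by (simp only: mult_2)
  finally show ?thesis
    unfolding even odd sum_lessThan_double by (simp only: N_def)
qed

lemma crosscorr_eq_sum:
  "crosscorr n \<alpha> d \<tau> = (\<Sum>t<3 ^ n - 1. psi (\<alpha> ^ \<tau> * \<alpha> ^ t - (\<alpha> ^ t) ^ d))"
proof -
  \<comment> \<open>This keeps the truncated subtraction in \<open>3 ^ n - 2\<close> exact.\<close>
  have "(3::nat) ^ n \<ge> 3 ^ 1" using n_pos by (intro power_increasing) auto
  then have "{0..3 ^ n - 2} = {..<3 ^ n - 1 :: nat}" by auto
  moreover have "psi (x - y) = omega_pow_diff (trace3 n x) (trace3 n y)" for x y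
    using psi_add[of x "- y"] unfolding psi_uminus by (simp add: psi_def omega_pow_diff_def)
  ultimately show ?thesis
    by (simp add: crosscorr_def mseq_def power_add mult.commute flip: power_mult)
qed

end

end

section \<open>Arithmetic of \<open>Q\<close> modulo 20 and of the exponent
  \<open>(Q + 9) / 2\<close>\<close>

lemma nine_power_odd:
  assumes "odd k"
  obtains j :: nat where "(3::nat) ^ (2 * k) = 20 * j + 9"
proof -
  \<comment> \<open>This gives \<open>9 * 81 ^ l\<close>, and 81 is 1 modulo 20.\<close>
  obtain l where k: "k = 2 * l + 1" using assms by (elim oddE)
  have "\<exists>j. (81::nat) ^ l = 20 * j + 1"
  proof (induction l)
    case (Suc l)
    then obtain j where "(81::nat) ^ l = 20 * j + 1" by blast
    then have "(81::nat) ^ Suc l = 20 * (81 * j + 4) + 1" by simp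
    then show ?case by blast
  qed simp
  then obtain j where j: "(81::nat) ^ l = 20 * j + 1" by blast
  have "(3::nat) ^ (2 * k) = 9 * 81 ^ l"
    by (simp add: k power_mult power_add)
  then have "(3::nat) ^ (2 * k) = 20 * (9 * j) + 9" using j by simp
  then show ?thesis using that by blast
qed

text \<open>With \<open>Q = 20 * j + 9\<close> these are \<open>(Q + 9) / 2\<close> and
  \<open>Q^2 - 1 = (Q + 1) * (Q - 1)\<close>. A common divisor with \<open>2 * j + 1\<close> divides
  4, one with \<open>10 * j + 4\<close> divides 5, and \<open>10 * j + 9\<close> is prime to
  both.\<close>

lemma coprime_exponent:
  fixes j :: nat
  shows "coprime (10 * j + 9) ((20 * j + 9)\<^sup>2 - 1)"
proof -
  have N: "(20 * j + 9)\<^sup>2 - 1 = 2 * 2 * 5 * (2 * j + 1) * (10 * j + 4)"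
    by (simp add: power2_eq_square algebra_simps)
  have 2: "coprime (10 * j + 9) 2" by simp
  then have 4: "coprime (10 * j + 9) 4"
    using coprime_mult_right_iff[of "10 * j + 9" 2 2] by simp
  have 5: "coprime (10 * j + 9) 5"
  proof (rule coprimeI)
    fix c assume "c dvd 10 * j + 9" "c dvd 5"
    then have "c dvd 10 * (j + 1) - (10 * j + 9)" by (intro dvd_diff_nat) (auto intro: dvd_trans[of _ 5])
    then show "is_unit c" by simp
  qed
  have a: "coprime (10 * j + 9) (2 * j + 1)"
  proof (rule coprimeI)
    fix c assume "c dvd 10 * j + 9" "c dvd 2 * j + 1"
    then have "c dvd (10 * j + 9) - 5 * (2 * j + 1)" by (intro dvd_diff_nat dvd_mult)
    then have "c dvd 4" by simp
    then show "is_unit c" using 4 \<open>c dvd 10 * j + 9\<close> by (rule coprime_common_divisor[rotated 2])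
  qed
  have b: "coprime (10 * j + 9) (10 * j + 4)"
  proof (rule coprimeI)
    fix c assume "c dvd 10 * j + 9" "c dvd 10 * j + 4"
    then have "c dvd (10 * j + 9) - (10 * j + 4)" by (intro dvd_diff_nat) auto
    then have "c dvd 5" by simp
    then show "is_unit c" using 5 \<open>c dvd 10 * j + 9\<close> by (rule coprime_common_divisor[rotated 2])
  qed
  show ?thesis
    unfolding N coprime_mult_right_iff using 2 5 a b by blast
qed

theorem theorem1:
  fixes k n d :: nat and \<alpha> :: "'a::{field,finite}"
  assumes "odd k"
    and "n = 4 * k"
    and "d = (3 ^ (2 * k) + 1)\<^sup>2 div 20"
    and "card (UNIV :: 'a set) = 3 ^ n"
    and "primitive_element \<alpha>"
    and "\<tau> \<le> 3 ^ n - 2"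
  shows "norm (crosscorr n \<alpha> d \<tau>) \<le> 5 * sqrt (3 ^ n) + 1"
proof -
  interpret finite_field_3n n "TYPE('a)" by unfold_locales fact
  note prim = assms(5)
  define Q :: nat where "Q = 3 ^ (2 * k)"
  obtain j where j: "Q = 20 * j + 9"
    using nine_power_odd[OF assms(1)] unfolding Q_def by blast
  \<comment> \<open>\<open>M = (Q + 1) / 10\<close> makes the division by 20 in \<open>d\<close>
    exact; its oddness gives the sign in \<open>nonsquare\<close>.\<close>
  define M where "M = 2 * j + 1"
  have QM: "Q + 1 = 10 * M" by (simp add: j M_def)
  have NQ: "3 ^ n = Q\<^sup>2" by (simp add: Q_def assms(2) flip: power_mult)
  have d: "d = 5 * M\<^sup>2"
    using assms(3) unfolding Q_def[symmetric] QM by (simp add: power_mult_distrib)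
  have pN: "x ^ (Q\<^sup>2 - 1) = 1" if "x \<noteq> 0" for x :: 'a
    using pow_order[OF that] by (simp add: NQ)
  define a where "a = \<alpha> ^ \<tau>"
  have a0: "a \<noteq> 0" using primitive_neq_0[OF prim] by (simp add: a_def)
  define F where "F x = psi (a * x - x ^ d)" for x
  define T1 where "T1 = (\<Sum>v\<in>UNIV. psi (a * \<alpha> * v\<^sup>2))"
  define T2 where "T2 = (\<Sum>v\<in>UNIV. psi (a * v ^ (Q + 9) - v ^ (Q + 1)))"

  have square: "F (v ^ (2 * (10 * j + 9))) = psi (a * v ^ (Q + 9) - v ^ (Q + 1))" if "v \<noteq> 0" for v
  proof -
    \<comment> \<open>Hence \<open>(Q + 9) * d\<close> is \<open>Q + 1\<close> modulo the group
      order.\<close>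
    have "(Q + 9) * d = (Q\<^sup>2 - 1) * (j + 1) + (Q + 1)"
      by (simp add: j d M_def power2_eq_square algebra_simps)
    then have "(v ^ (Q + 9)) ^ d = (v ^ (Q\<^sup>2 - 1)) ^ (j + 1) * v ^ (Q + 1)"
      by (metis power_add power_mult)
    then have "(v ^ (Q + 9)) ^ d = v ^ (Q + 1)" using pN[OF that] by simp
    moreover have "2 * (10 * j + 9) = Q + 9" by (simp add: j)
    ultimately show ?thesis by (simp only: F_def)
  qed

  have nonsquare: "F (\<alpha> * v\<^sup>2) = psi (a * \<alpha> * v\<^sup>2)" if "v \<noteq> 0" for v
  proof -
    define y where "y = (\<alpha> * v\<^sup>2) ^ d"
    define h where "h = 10 * M * (10 * j + 4)"
    have h: "2 * h = Q\<^sup>2 - 1"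
      by (simp add: h_def j M_def power2_eq_square algebra_simps)
    \<comment> \<open>So \<open>y ^ Q\<close> is \<open>y\<close> times the \<open>M\<close>-th
      power of the quadratic character, which is -1 on nonsquares.\<close>
    have dQ: "d * Q = h * M + d"
      by (simp add: h_def d j M_def power2_eq_square algebra_simps)
    have "(\<alpha> * v\<^sup>2) ^ h = - 1"
      using primitive_power_half[OF prim, of h] h pN[OF that]
      by (simp add: NQ power_mult_distrib flip: power_mult)
    then have "y ^ Q = (- 1) ^ M * y"
      unfolding y_def power_mult[symmetric] dQ by (simp add: power_add power_mult)
    then have "y ^ Q = - y" by (simp add: M_def)
    \<comment> \<open>\<open>Q\<close> is a power of 3, so \<open>y\<close> and \<open>y ^ Q\<close>
      have the same trace.\<close>
    then have "trace3 n y = - trace3 n y"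
      using trace_frob[of y "2 * k"] by (simp add: Q_def trace_uminus)
    then have "2 * trace3 n y = 0" by (simp only: eq_neg_iff_add_eq_0 mult_2)
    then have "trace3 n y = 0" using two_neq_0 by simp
    then have "psi (- y) = 1" by (simp add: psi_uminus psi_eq_1)
    moreover have "F (\<alpha> * v\<^sup>2) = psi (a * \<alpha> * v\<^sup>2 + - y)"
      by (simp add: F_def y_def mult.assoc)
    ultimately show ?thesis by (simp only: psi_add) simp
  qed

  have "coprime (10 * j + 9) (3 ^ n - 1)"
    unfolding NQ j by (rule coprime_exponent)
  from double_sum_nonzero[OF prim this, of F]
  have "2 * crosscorr n \<alpha> d \<tau>
      = (\<Sum>v\<in>UNIV - {0}. F (v ^ (2 * (10 * j + 9)))) + (\<Sum>v\<in>UNIV - {0}. F (\<alpha> * v\<^sup>2))"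
    by (simp only: crosscorr_eq_sum[OF prim] F_def a_def)
  also have "\<dots> = (\<Sum>v\<in>UNIV - {0}. psi (a * v ^ (Q + 9) - v ^ (Q + 1))) + (\<Sum>v\<in>UNIV - {0}. psi (a * \<alpha> * v\<^sup>2))"
    by (intro arg_cong2[of _ _ _ _ "(+)"] sum.cong refl square nonsquare) auto
  \<comment> \<open>The two subtracted ones are the terms at \<open>v = 0\<close>.\<close>
  also have "\<dots> = (T2 - 1) + (T1 - 1)"
    by (simp add: T1_def T2_def sum_diff1 j power_0_left)
  finally have C: "2 * crosscorr n \<alpha> d \<tau> = T1 + T2 - 2" by simp

  have NQ': "3 ^ n = (real Q)\<^sup>2" using NQ by (metis of_nat_numeral of_nat_power)
  have "(norm T1)\<^sup>2 \<le> (real Q)\<^sup>2"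
    using gauss_sum_bound[of "a * \<alpha>"] a0 primitive_neq_0[OF prim]
    by (simp add: T1_def NQ')
  then have T1: "norm T1 \<le> Q" by (rule power2_le_imp_le) simp
  have "(norm T2)\<^sup>2 \<le> 3 ^ n * 81"
    using quadratic_sum_bound_Q[of "2 * k" a] a0 assms(2) by (simp add: T2_def Q_def)
  then have "(norm T2)\<^sup>2 \<le> (9 * real Q)\<^sup>2" by (simp add: NQ' power_mult_distrib mult.commute)
  then have T2: "norm T2 \<le> 9 * real Q" by (rule power2_le_imp_le) simp

  have "2 * norm (crosscorr n \<alpha> d \<tau>) = norm (T1 + T2 - 2)"
    unfolding C[symmetric] by (simp add: norm_mult)
  also have "\<dots> \<le> norm T1 + norm T2 + 2"
    using norm_triangle_ineq4[of "T1 + T2" 2] norm_triangle_ineq[of T1 T2] by simp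
  \<comment> \<open>The constants come from \<open>(Q + 9 * Q + 2) / 2\<close>.\<close>
  finally have "norm (crosscorr n \<alpha> d \<tau>) \<le> 5 * real Q + 1" using T1 T2 by simp
  moreover have "sqrt (3 ^ n) = real Q"
    by (simp add: NQ')
  ultimately show ?thesis by simp
qed

end
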